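(* Let $A,B,C,D\in\mathcal{T}_n\otimes\mathcal{M}_d$ be block Toeplitz matrices. Then $AB-CD\in\mathcal{T}_n\otimes\mathcal{M}_d$ if and only if $$\tilde{A}_-\tilde{B}_+-\tilde{A}_+\tilde{B}_-=\tilde{C}_-\tilde{D}_+-\tilde{C}_+\tilde{D}_-.$$
   Context: Let $n,d\ge 1$. $\mathcal{M}_d$ is the algebra of complex $d\times d$ matrices, and $\mathcal{M}_n\otimes\mathcal{M}_d$ is the set of $n\times n$ block matrices with blocks in $\mathcal{M}_d$, block rows and columns being indexed from $0$ to $n-1$. $\mathcal{T}_n\otimes\mathcal{M}_d\subset\mathcal{M}_n\otimes\mathcal{M}_d$ is the set of block Toeplitz matrices, i.e. block matrices whose $(i,j)$ block depends only on the difference $j-i$. For a block Toeplitz matrix $A$, write $A_m\in\mathcal{M}_d$ ($-(n-1)\le m\le n-1$) for the common value of its $(i,j)$ blocks with $j-i=m$ (so the first block row is $A_0,A_1,\dots,A_{n-1}$ and the first block column is $A_0,A_{-1},\dots,A_{-(n-1)}$). For a block Toeplitz matrix $A$ define the $n\times 1$ block columns $\tilde{A}_-$ with entries, from top to bottom, $0,A_{-1},A_{-2},\dots,A_{-(n-1)}$, and $\tilde{A}_+$ with entries $0,A_{n-1},A_{n-2},\dots,A_{1}$; define $\tilde{C}_-,\tilde{C}_+$ from $C$ in the same way. For a block Toeplitz matrix $B$ define the $1\times n$ block rows $\tilde{B}_+=(0,B_1,B_2,\dots,B_{n-1})$ and $\tilde{B}_-=(0,B_{1-n},B_{2-n},\dots,B_{-1})$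 (blocks themselves not transposed); define $\tilde{D}_+,\tilde{D}_-$ from $D$ in the same way. The product of an $n\times1$ block column and a $1\times n$ block row is the $n\times n$ block matrix given by block multiplication. *)

theory Defs
  imports Complex_Main "Jordan_Normal_Form.Matrix"
begin

(* An n x n block matrix with d x d complex blocks (an element of M_n (x) M_d) is an ordinary
   complex matrix of size (n * d) x (n * d), partitioned into blocks: the entry in row a and
   column b of block (i, j) is the entry in row i * d + a and column j * d + b.  All indices
   start at 0.  Block multiplication is then the ordinary matrix product. *)

definition block :: "nat \<Rightarrow> complex mat \<Rightarrow> nat \<Rightarrow> nat \<Rightarrow> complex mat" where
  "block d A i j = mat d d (\<lambda>(a, b). A $$ (i * d + a, j * d + b))"

definition block_toeplitz :: "nat \<Rightarrow> nat \<Rightarrow> complex mat set" where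
  "block_toeplitz n d = {A \<in> carrier_mat (n * d) (n * d).
     \<forall>i<n. \<forall>j<n. \<forall>i'<n. \<forall>j'<n.
       int j - int i = int j' - int i' \<longrightarrow> block d A i j = block d A i' j'}"

(* A_m, the common value of the blocks (i, j) with j - i = m, read off from the first block row
   (m >= 0) or the first block column (m < 0).  Meaningful for block Toeplitz A and |m| < n. *)
definition toeplitz_coeff :: "nat \<Rightarrow> complex mat \<Rightarrow> int \<Rightarrow> complex mat" where
  "toeplitz_coeff d A m = (if m \<ge> 0 then block d A 0 (nat m) else block d A (nat (- m)) 0)"

definition block_col :: "nat \<Rightarrow> nat \<Rightarrow> (nat \<Rightarrow> complex mat) \<Rightarrow> complex mat" where
  "block_col n d X = mat (n * d) d (\<lambda>(r, b). X (r div d) $$ (r mod d, b))"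

definition block_row :: "nat \<Rightarrow> nat \<Rightarrow> (nat \<Rightarrow> complex mat) \<Rightarrow> complex mat" where
  "block_row n d X = mat d (n * d) (\<lambda>(a, c). X (c div d) $$ (a, c mod d))"

(* 0, A_{-1}, A_{-2}, ..., A_{-(n-1)} *)
definition col_minus :: "nat \<Rightarrow> nat \<Rightarrow> complex mat \<Rightarrow> complex mat" where
  "col_minus n d A =
     block_col n d (\<lambda>i. if i = 0 then 0\<^sub>m d d else toeplitz_coeff d A (- int i))"

(* 0, A_{n-1}, A_{n-2}, ..., A_1 *)
definition col_plus :: "nat \<Rightarrow> nat \<Rightarrow> complex mat \<Rightarrow> complex mat" where
  "col_plus n d A =
     block_col n d (\<lambda>i. if i = 0 then 0\<^sub>m d d else toeplitz_coeff d A (int n - int i))"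

(* 0, B_1, B_2, ..., B_{n-1} *)
definition row_plus :: "nat \<Rightarrow> nat \<Rightarrow> complex mat \<Rightarrow> complex mat" where
  "row_plus n d B =
     block_row n d (\<lambda>j. if j = 0 then 0\<^sub>m d d else toeplitz_coeff d B (int j))"

(* 0, B_{1-n}, B_{2-n}, ..., B_{-1} *)
definition row_minus :: "nat \<Rightarrow> nat \<Rightarrow> complex mat \<Rightarrow> complex mat" where
  "row_minus n d B =
     block_row n d (\<lambda>j. if j = 0 then 0\<^sub>m d d else toeplitz_coeff d B (int j - int n))"

end

theory Submission
  imports Defs
begin

text \<open>
  A matrix is block Toeplitz exactly when it is unchanged by moving one block down and one block
  to the right, that is, when the entries in positions \<open>(r, c)\<close> and \<open>(r + d, c + d)\<close> always agree
  (\<open>block_toeplitz_iff_shift\<close>).  So everything depends on the difference of these two entries for a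
  product of block Toeplitz matrices \<open>A\<close> and \<open>B\<close>.  By shift invariance of the factors, the sums
  \<open>\<Sum>k. A(r + d, k) B(k, c + d)\<close> and \<open>\<Sum>k. A(r, k) B(k, c)\<close> have all terms in common
  except the first block of the former and the last block of the latter.
  These remaining terms are precisely the entries of
  \<open>col_minus A * row_plus B - col_plus A * row_minus B\<close> in position \<open>(r + d, c + d)\<close>, and
  the entries of that matrix in the block row and the block column of index \<open>0\<close> vanish
  (\<open>displacement_of_product\<close>).  Since the displacement is additive, \<open>A B - C D\<close> is
  shift-invariant if and only if the displacement matrices of the two products coincide.
\<close>

section \<open>Block Toeplitz matrices as shift-invariant matrices\<close>

lemma block_index_less:
  fixes i n a d :: nat
  assumes "i < n" "a < d"
  shows "i * d + a < n * d"
proof -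
  have "i * d + a < Suc i * d" using assms(2) by simp
  also have "\<dots> \<le> n * d" using assms(1) by (intro mult_le_mono1) simp
  finally show ?thesis .
qed

lemma block_index_div_mod:
  fixes r n d :: nat
  assumes "r < n * d"
  shows "r div d < n" "r mod d < d" "r div d * d + r mod d = r"
proof -
  have "d > 0" using assms by (cases d) auto
  then show "r div d < n" "r mod d < d" "r div d * d + r mod d = r"
    using assms by (auto simp: less_mult_imp_div_less)
qed

lemma shift_invariant_iterate:
  fixes f :: "nat \<Rightarrow> nat \<Rightarrow> 'a"
  assumes "\<And>r c. r + d < N \<Longrightarrow> c + d < N \<Longrightarrow> f (r + d) (c + d) = f r c"
    and "r + m * d < N" "c + m * d < N"
  shows "f (r + m * d) (c + m * d) = f r c"
  using assms(2,3)
proof (induction m)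
  case (Suc m)
  have "f (r + Suc m * d) (c + Suc m * d) = f (r + m * d + d) (c + m * d + d)"
    by (simp add: algebra_simps)
  also have "\<dots> = f (r + m * d) (c + m * d)"
    using Suc.prems by (intro assms(1)) (simp_all add: algebra_simps)
  also have "\<dots> = f r c"
    using Suc by simp
  finally show ?case .
qed simp

lemma block_toeplitz_iff_shift:
  assumes A: "A \<in> carrier_mat (n * d) (n * d)"
  shows "A \<in> block_toeplitz n d \<longleftrightarrow>
    (\<forall>r c. r + d < n * d \<longrightarrow> c + d < n * d \<longrightarrow> A $$ (r + d, c + d) = A $$ (r, c))"
    (is "_ \<longleftrightarrow> ?shift")
proof
  assume T: "A \<in> block_toeplitz n d"
  show ?shift
  proof (intro allI impI)
    fix r c assume r: "r + d < n * d" and c: "c + d < n * d"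
    have d: "d > 0" using r by (cases d) auto
    have T': "block d A i j = block d A i' j'"
      if "i < n" "j < n" "i' < n" "j' < n" "int j - int i = int j' - int i'" for i j i' j'
      using T that unfolding block_toeplitz_def by blast
    define i a j b where "i = r div d" "a = r mod d" "j = c div d" "b = c mod d"
    note defs = this
    have r': "i * d + a = r" "a < d" and c': "j * d + b = c" "b < d"
      using d by (simp_all add: defs)
    have "Suc i < n" "Suc j < n"
      using block_index_div_mod(1)[OF r] block_index_div_mod(1)[OF c] d by (simp_all add: defs)
    then have "block d A (Suc i) (Suc j) = block d A i j"
      by (intro T') simp_all
    then have "block d A (Suc i) (Suc j) $$ (a, b) = block d A i j $$ (a, b)" by simp
    then have "A $$ (Suc i * d + a, Suc j * d + b) = A $$ (i * d + a, j * d + b)"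
      using r' c' by (simp add: block_def)
    moreover have "Suc i * d + a = r + d" "Suc j * d + b = c + d"
      using r' c' by auto
    ultimately show "A $$ (r + d, c + d) = A $$ (r, c)"
      by (simp only: r'(1) c'(1))
  qed
next
  assume S: ?shift
  have eq: "block d A (i + m) (j + m) = block d A i j" if "i + m < n" "j + m < n" for i j m
  proof (rule eq_matI)
    fix a b assume "a < dim_row (block d A i j)" "b < dim_col (block d A i j)"
    then have ab: "a < d" "b < d" by (simp_all add: block_def)
    have "A $$ (i * d + a + m * d, j * d + b + m * d) = A $$ (i * d + a, j * d + b)"
    proof (rule shift_invariant_iterate[where f = "\<lambda>r c. A $$ (r, c)" and N = "n * d"])
      show "i * d + a + m * d < n * d" "j * d + b + m * d < n * d"
        using block_index_less[OF that(1) ab(1)] block_index_less[OF that(2) ab(2)]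
        by (simp_all add: algebra_simps)
    qed (use S in blast)
    then show "block d A (i + m) (j + m) $$ (a, b) = block d A i j $$ (a, b)"
      using ab by (simp add: block_def algebra_simps)
  qed (simp_all add: block_def)
  have "block d A i j = block d A i' j'"
    if "i < n" "j < n" "i' < n" "j' < n" and diff: "int j - int i = int j' - int i'" for i j i' j'
  proof (cases "i \<le> i'")
    case True
    then have "i' = i + (i' - i)" "j' = j + (i' - i)" using diff by auto
    then show ?thesis using eq[of i "i' - i" j] that by simp
  next
    case False
    then have "i = i' + (i - i')" "j = j' + (i - i')" using diff by auto
    then show ?thesis using eq[of i' "i - i'" j'] that by simp
  qed
  then show "A \<in> block_toeplitz n d"
    using A unfolding block_toeplitz_def by blast
qed

lemma block_toeplitz_carrier: "A \<in> block_toeplitz n d \<Longrightarrow> A \<in> carrier_mat (n * d) (n * d)"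
  by (simp add: block_toeplitz_def)

lemma block_toeplitz_shift:
  assumes "A \<in> block_toeplitz n d" "r + m * d < n * d" "c + m * d < n * d"
  shows "A $$ (r + m * d, c + m * d) = A $$ (r, c)"
proof (rule shift_invariant_iterate[where f = "\<lambda>r c. A $$ (r, c)" and N = "n * d"])
  show "A $$ (r + d, c + d) = A $$ (r, c)" if "r + d < n * d" "c + d < n * d" for r c
    using that assms(1) block_toeplitz_iff_shift[OF block_toeplitz_carrier[OF assms(1)]] by blast
qed fact+

section \<open>Entries of the block columns and block rows\<close>

lemma dim_col_row [simp]:
  "dim_row (col_minus n d A) = n * d" "dim_col (col_minus n d A) = d"
  "dim_row (col_plus n d A) = n * d" "dim_col (col_plus n d A) = d"
  "dim_row (row_plus n d A) = d" "dim_col (row_plus n d A) = n * d"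
  "dim_row (row_minus n d A) = d" "dim_col (row_minus n d A) = n * d"
  by (simp_all add: col_minus_def col_plus_def row_plus_def row_minus_def
      block_col_def block_row_def)

lemma col_row_carrier:
  "col_minus n d A \<in> carrier_mat (n * d) d" "col_plus n d A \<in> carrier_mat (n * d) d"
  "row_plus n d A \<in> carrier_mat d (n * d)" "row_minus n d A \<in> carrier_mat d (n * d)"
  by (intro carrier_matI; simp)+

lemma div_eq_0_iff_less: "r div d = 0 \<longleftrightarrow> r < d" if "d > 0" for r d :: nat
  using that by (simp add: div_eq_0_iff)

lemma col_minus_index:
  assumes "r < n * d" "k < d"
  shows "col_minus n d A $$ (r, k) = (if r < d then 0 else A $$ (r, k))"
  using assms block_index_div_mod[OF assms(1)]
  by (auto simp: col_minus_def block_col_def toeplitz_coeff_def block_def div_eq_0_iff_less)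

lemma row_plus_index:
  assumes "c < n * d" "k < d"
  shows "row_plus n d B $$ (k, c) = (if c < d then 0 else B $$ (k, c))"
  using assms block_index_div_mod[OF assms(1)]
  by (auto simp: row_plus_def block_row_def toeplitz_coeff_def block_def div_eq_0_iff_less)

text \<open>
  Index arithmetic for moving the block \<open>(0, n - i)\<close>, where \<open>i = r div d\<close>, down and to the right by
  \<open>i - 1\<close> blocks: it arrives at the block \<open>(i - 1, n - 1)\<close>.
\<close>

lemma last_block_index:
  fixes r n d k :: nat
  assumes r: "r < n * d" "d \<le> r"
  shows "r mod d + (r div d - 1) * d = r - d"
    and "(n - r div d) * d + k + (r div d - 1) * d = (n - 1) * d + k"
    and "1 \<le> r div d" "r div d < n"
proof -
  note dm = block_index_div_mod[OF r(1)]
  have "d > 0" using dm by simp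
  then show q: "1 \<le> r div d" using r(2) by (simp add: div_greater_zero_iff Suc_le_eq)
  show qn: "r div d < n" by (fact dm(1))
  obtain q' where q': "r div d = Suc q'" using q by (cases "r div d") auto
  show "r mod d + (r div d - 1) * d = r - d"
    using dm(3) q' by simp
  have "(n - r div d) + (r div d - 1) = n - 1" using q qn by simp
  then show "(n - r div d) * d + k + (r div d - 1) * d = (n - 1) * d + k"
    by (metis add.assoc add.commute add_mult_distrib)
qed

text \<open>
  Away from its zero block, \<open>col_plus\<close> is the last block column of \<open>A\<close> moved down by one block.
  Likewise, \<open>row_minus\<close> is the last block row moved to the right by one block.
\<close>

lemma col_plus_index:
  assumes A: "A \<in> block_toeplitz n d" and r: "r < n * d" and k: "k < d"
  shows "col_plus n d A $$ (r, k) = (if r < d then 0 else A $$ (r - d, (n - 1) * d + k))"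
proof (cases "r < d")
  case True
  then show ?thesis using r k by (simp add: col_plus_def block_col_def)
next
  case False
  then have le: "d \<le> r" by simp
  note idx = last_block_index[OF r le]
  have N: "(n - 1) * d + k < n * d" using idx k by (intro block_index_less) auto
  have "int n - int (r div d) \<ge> 0" "nat (int n - int (r div d)) = n - r div d"
    using idx(4) by auto
  then have "col_plus n d A $$ (r, k) = A $$ (r mod d, (n - r div d) * d + k)"
    using r k idx block_index_div_mod(2)[OF r]
    by (simp add: col_plus_def block_col_def toeplitz_coeff_def block_def)
  also have "\<dots> = A $$ (r mod d + (r div d - 1) * d, (n - r div d) * d + k + (r div d - 1) * d)"
    using idx N r by (intro block_toeplitz_shift[OF A, symmetric]) auto
  finally show ?thesis unfolding idx(1,2) using False by simp
qed

lemma row_minus_index: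
  assumes B: "B \<in> block_toeplitz n d" and c: "c < n * d" and k: "k < d"
  shows "row_minus n d B $$ (k, c) = (if c < d then 0 else B $$ ((n - 1) * d + k, c - d))"
proof (cases "c < d")
  case True
  then show ?thesis using c k by (simp add: row_minus_def block_row_def)
next
  case False
  then have le: "d \<le> c" by simp
  note idx = last_block_index[OF c le]
  have N: "(n - 1) * d + k < n * d" using idx k by (intro block_index_less) auto
  have "\<not> int (c div d) - int n \<ge> 0" "nat (- (int (c div d) - int n)) = n - c div d"
    using idx(4) by auto
  then have "row_minus n d B $$ (k, c) = B $$ ((n - c div d) * d + k, c mod d)"
    using c k idx block_index_div_mod(2)[OF c]
    by (simp add: row_minus_def block_row_def toeplitz_coeff_def block_def)
  also have "\<dots> = B $$ ((n - c div d) * d + k + (c div d - 1) * d, c mod d + (c div d - 1) * d)"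
    using idx N c by (intro block_toeplitz_shift[OF B, symmetric]) auto
  finally show ?thesis unfolding idx(1,2) using False by simp
qed

section \<open>The displacement of a product\<close>

lemma mult_mat_index_sum:
  assumes "X \<in> carrier_mat p m" "Y \<in> carrier_mat m q" "r < p" "c < q"
  shows "(X * Y) $$ (r, c) = (\<Sum>k<m. X $$ (r, k) * Y $$ (k, c))"
  using assms by (simp add: scalar_prod_def atLeast0LessThan)

lemma sum_split_at:
  fixes f :: "nat \<Rightarrow> 'a :: comm_monoid_add"
  shows "(\<Sum>k<p + q. f k) = (\<Sum>k<p. f k) + (\<Sum>k<q. f (p + k))"
  by (induction q) (simp_all add: add.assoc)

text \<open>
  The matrix formed from the block columns of \<open>A\<close> and the block rows of \<open>B\<close> is the displacement of
  \<open>A * B\<close>: it measures the failure of the product to be invariant under diagonal block shifts.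
\<close>

lemma displacement_of_product:
  assumes A: "A \<in> block_toeplitz n d" and B: "B \<in> block_toeplitz n d"
    and r: "r < n * d" and c: "c < n * d"
  shows "(col_minus n d A * row_plus n d B - col_plus n d A * row_minus n d B) $$ (r, c) =
    (if r < d \<or> c < d then 0 else (A * B) $$ (r, c) - (A * B) $$ (r - d, c - d))"
proof -
  have "(col_minus n d A * row_plus n d B - col_plus n d A * row_minus n d B) $$ (r, c) =
    (col_minus n d A * row_plus n d B) $$ (r, c) - (col_plus n d A * row_minus n d B) $$ (r, c)"
    using r c by simp
  also have "\<dots> = (\<Sum>k<d. col_minus n d A $$ (r, k) * row_plus n d B $$ (k, c)) -
      (\<Sum>k<d. col_plus n d A $$ (r, k) * row_minus n d B $$ (k, c))"
    by (simp add: mult_mat_index_sum[OF col_row_carrier(1) col_row_carrier(3) r c]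
        mult_mat_index_sum[OF col_row_carrier(2) col_row_carrier(4) r c])
  also have "\<dots> = (\<Sum>k<d. (if r < d then 0 else A $$ (r, k)) * (if c < d then 0 else B $$ (k, c))) -
      (\<Sum>k<d. (if r < d then 0 else A $$ (r - d, (n - 1) * d + k)) *
        (if c < d then 0 else B $$ ((n - 1) * d + k, c - d)))"
    using r c A B
    by (intro arg_cong2[where f = minus] sum.cong)
      (simp_all add: col_minus_index row_plus_index col_plus_index row_minus_index)
  finally have Q:
    "(col_minus n d A * row_plus n d B - col_plus n d A * row_minus n d B) $$ (r, c) = \<dots>" .
  show ?thesis
  proof (cases "r < d \<or> c < d")
    case True
    then show ?thesis unfolding Q by auto
  next
    case False
    define m where "m = (n - 1) * d"
    have n: "n * d = d + m" "n * d = m + d"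
      using r by (cases n; simp add: m_def)+
    note Ac = block_toeplitz_carrier[OF A] and Bc = block_toeplitz_carrier[OF B]
    have "(A * B) $$ (r, c) = (\<Sum>k<d + m. A $$ (r, k) * B $$ (k, c))"
      using mult_mat_index_sum[OF Ac Bc r c] n by simp
    also have "\<dots> = (\<Sum>k<d. A $$ (r, k) * B $$ (k, c)) +
        (\<Sum>k<m. A $$ (r, d + k) * B $$ (d + k, c))"
      by (rule sum_split_at)
    \<comment> \<open>Here the summation index is moved together with \<open>r\<close> and \<open>c\<close>.\<close>
    also have "(\<Sum>k<m. A $$ (r, d + k) * B $$ (d + k, c)) =
        (\<Sum>k<m. A $$ (r - d, k) * B $$ (k, c - d))"
    proof (intro sum.cong refl arg_cong2[where f = times])
      fix k assume "k \<in> {..<m}"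
      then show "A $$ (r, d + k) = A $$ (r - d, k)" "B $$ (d + k, c) = B $$ (k, c - d)"
        using block_toeplitz_shift[OF A, of "r - d" 1 k]
          block_toeplitz_shift[OF B, of k 1 "c - d"] False r c n(1)
        by (simp_all add: add.commute[of d k])
    qed
    finally have 1: "(A * B) $$ (r, c) = (\<Sum>k<d. A $$ (r, k) * B $$ (k, c)) +
        (\<Sum>k<m. A $$ (r - d, k) * B $$ (k, c - d))" .
    have "(A * B) $$ (r - d, c - d) = (\<Sum>k<m + d. A $$ (r - d, k) * B $$ (k, c - d))"
      using mult_mat_index_sum[OF Ac Bc, of "r - d" "c - d"] r c n(2) by simp
    also have "\<dots> = (\<Sum>k<m. A $$ (r - d, k) * B $$ (k, c - d)) +
        (\<Sum>k<d. A $$ (r - d, m + k) * B $$ (m + k, c - d))"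
      by (rule sum_split_at)
    \<comment> \<open>The sums over \<open>k < m\<close> cancel.\<close>
    finally show ?thesis
      using 1 False unfolding Q m_def by simp
  qed
qed

theorem theorem3p3:
  fixes n d :: nat and A B C D :: "complex mat"
  assumes "n \<ge> 1" and "d \<ge> 1"
    and "A \<in> block_toeplitz n d" and "B \<in> block_toeplitz n d"
    and "C \<in> block_toeplitz n d" and "D \<in> block_toeplitz n d"
  shows "A * B - C * D \<in> block_toeplitz n d \<longleftrightarrow>
    col_minus n d A * row_plus n d B - col_plus n d A * row_minus n d B =
    col_minus n d C * row_plus n d D - col_plus n d C * row_minus n d D"
    (is "_ \<longleftrightarrow> ?P = ?Q")
proof -
  note carr = assms(3-6)[THEN block_toeplitz_carrier]
  let ?M = "A * B - C * D"
  have M: "?M \<in> carrier_mat (n * d) (n * d)" using carr by auto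
  have M_index: "?M $$ (r, c) = (A * B) $$ (r, c) - (C * D) $$ (r, c)"
    if "r < n * d" "c < n * d" for r c
    using carr that by (intro index_minus_mat) auto
  have "?M \<in> block_toeplitz n d \<longleftrightarrow>
      (\<forall>r c. r + d < n * d \<longrightarrow> c + d < n * d \<longrightarrow> ?M $$ (r + d, c + d) = ?M $$ (r, c))"
    by (rule block_toeplitz_iff_shift[OF M])
  also have "\<dots> \<longleftrightarrow> (\<forall>r c. r + d < n * d \<longrightarrow> c + d < n * d \<longrightarrow>
      ?P $$ (r + d, c + d) = ?Q $$ (r + d, c + d))"
  proof (intro all_cong1 imp_cong refl)
    fix r c assume rc: "r + d < n * d" "c + d < n * d"
    have "?P $$ (r + d, c + d) = (A * B) $$ (r + d, c + d) - (A * B) $$ (r, c)"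
      by (subst displacement_of_product[OF assms(3,4) rc]) simp
    moreover have "?Q $$ (r + d, c + d) = (C * D) $$ (r + d, c + d) - (C * D) $$ (r, c)"
      by (subst displacement_of_product[OF assms(5,6) rc]) simp
    moreover have "?M $$ (r, c) = (A * B) $$ (r, c) - (C * D) $$ (r, c)"
      using rc by (intro M_index) simp_all
    ultimately show "?M $$ (r + d, c + d) = ?M $$ (r, c) \<longleftrightarrow>
        ?P $$ (r + d, c + d) = ?Q $$ (r + d, c + d)"
      by (simp only: M_index[OF rc]) (auto simp: algebra_simps)
  qed
  also have "\<dots> \<longleftrightarrow> ?P = ?Q"
  proof
    assume E: "\<forall>r c. r + d < n * d \<longrightarrow> c + d < n * d \<longrightarrow>
      ?P $$ (r + d, c + d) = ?Q $$ (r + d, c + d)"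
    show "?P = ?Q"
    proof (rule eq_matI)
      fix r c assume "r < dim_row ?Q" "c < dim_col ?Q"
      then have rc: "r < n * d" "c < n * d"
        by simp_all
      show "?P $$ (r, c) = ?Q $$ (r, c)"
      proof (cases "r < d \<or> c < d")
        case True
        then show ?thesis
          using displacement_of_product[OF assms(3,4) rc] displacement_of_product[OF assms(5,6) rc]
          by simp
      next
        case False
        then show ?thesis
          using E[rule_format, of "r - d" "c - d"] rc by simp
      qed
    qed simp_all
  qed simp
  finally show ?thesis .
qed

end
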